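(* Let $N\ge1$, let $a\in\mathbb{R}^N$, and let $\{E_1,\dots,E_{N+1}\}$ be the canonical basis of $T_0\mathbb{R}^{N+1}$. Let $P=\lambda E_{N+1}+\mu X$ and $Q=Y$, where $\lambda^2+\mu^2=1$ and $X=\sum_{i=1}^N X_iE_i$, $Y=\sum_{i=1}^N Y_iE_i$ are vectors in the span of $E_1,\dots,E_N$ such that $P$ and $Q$ are orthonormal with respect to $g_a$. Then the sectional curvature, with respect to $g_a$, of the $2$-plane spanned by $\{P,Q\}$ is $$\kappa=-\lambda^2\sum_{i=1}^N a_i^2Y_i^2-\mu^2\left(\sum_{i=1}^N a_iX_i^2\cdot\sum_{i=1}^N a_iY_i^2-\Big(\sum_{i=1}^N a_iX_iY_i\Big)^2\right).$$ In particular, if all the coordinates $a_i$ are of the same sign (all positive or all negative), then $(\mathbb{R}^{N+1},g_a)$ is of negative, pinched sectional curvature.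
   Context: For $a\in\mathbb{R}^N$, $g_a$ is the Riemannian metric on $\mathbb{R}^{N+1}$ given by $g_a=\sum_{i=1}^{N}e^{-2a_ix_{N+1}}\,dx_i^2+dx_{N+1}^2$. "Negative, pinched sectional curvature" means that there are constants $0<k\le K$ such that every sectional curvature $\kappa$ of the manifold satisfies $-K\le\kappa\le-k$. *)

theory Defs
  imports "HOL-Analysis.Analysis"
begin

text \<open>
  A Riemannian metric on \<open>\<real>\<^sup>m\<close> is given by its Gram matrix field in the global coordinates; each
  tangent space is identified with \<open>\<real>\<^sup>m\<close>, the coordinate fields being \<open>axis i 1\<close>.
\<close>

type_synonym 'm metric = "real^'m \<Rightarrow> real^'m^'m"

definition metric_inner :: "'m::finite metric \<Rightarrow> real^'m \<Rightarrow> real^'m \<Rightarrow> real^'m \<Rightarrow> real" where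
  "metric_inner g x u v = u \<bullet> (g x *v v)"

definition partial_deriv :: "'m::finite \<Rightarrow> (real^'m \<Rightarrow> real) \<Rightarrow> real^'m \<Rightarrow> real" where
  "partial_deriv i f x = deriv (\<lambda>t. f (x + t *\<^sub>R axis i 1)) 0"

text \<open>
  Christoffel symbols of the Levi-Civita connection: \<open>christoffel g k i j\<close> is the \<open>k\<close>-th component
  of \<open>\<nabla>\<^sub>i \<partial>\<^sub>j\<close>.
\<close>

definition christoffel :: "'m::finite metric \<Rightarrow> 'm \<Rightarrow> 'm \<Rightarrow> 'm \<Rightarrow> real^'m \<Rightarrow> real" where
  "christoffel g k i j x =
     (1/2) * (\<Sum>l\<in>UNIV. matrix_inv (g x) $ k $ l *
       (partial_deriv i (\<lambda>y. g y $ j $ l) x + partial_deriv j (\<lambda>y. g y $ i $ l) x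
        - partial_deriv l (\<lambda>y. g y $ i $ j) x))"

text \<open>
  \<open>riemann_coeff g l i j k\<close> is the \<open>l\<close>-th component of \<open>R(\<partial>\<^sub>i, \<partial>\<^sub>j) \<partial>\<^sub>k\<close>, with the convention
  \<open>R(U, V) W = \<nabla>\<^sub>U \<nabla>\<^sub>V W - \<nabla>\<^sub>V \<nabla>\<^sub>U W - \<nabla>\<^bsub>[U, V]\<^esub> W\<close>.
\<close>

definition riemann_coeff ::
  "'m::finite metric \<Rightarrow> 'm \<Rightarrow> 'm \<Rightarrow> 'm \<Rightarrow> 'm \<Rightarrow> real^'m \<Rightarrow> real" where
  "riemann_coeff g l i j k x =
     partial_deriv i (christoffel g l j k) x - partial_deriv j (christoffel g l i k) x
     + (\<Sum>m\<in>UNIV. christoffel g l i m x * christoffel g m j k x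
                - christoffel g l j m x * christoffel g m i k x)"

definition riemann ::
  "'m::finite metric \<Rightarrow> real^'m \<Rightarrow> real^'m \<Rightarrow> real^'m \<Rightarrow> real^'m \<Rightarrow> real^'m" where
  "riemann g x u v w =
     (\<chi> l. \<Sum>i\<in>UNIV. \<Sum>j\<in>UNIV. \<Sum>k\<in>UNIV. riemann_coeff g l i j k x * u $ i * v $ j * w $ k)"

text \<open>
  Sectional curvature at \<open>x\<close> of the plane spanned by the linearly independent vectors \<open>u\<close>, \<open>v\<close>.
\<close>

definition sectional_curvature ::
  "'m::finite metric \<Rightarrow> real^'m \<Rightarrow> real^'m \<Rightarrow> real^'m \<Rightarrow> real" where
  "sectional_curvature g x u v =
     metric_inner g x (riemann g x u v v) u /
     (metric_inner g x u u * metric_inner g x v v - (metric_inner g x u v)\<^sup>2)"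

definition negative_pinched_curvature :: "'m::finite metric \<Rightarrow> bool" where
  "negative_pinched_curvature g \<longleftrightarrow>
     (\<exists>k K. 0 < k \<and> k \<le> K \<and>
       (\<forall>x u v. u \<noteq> v \<and> independent {u, v} \<longrightarrow>
          - K \<le> sectional_curvature g x u v \<and> sectional_curvature g x u v \<le> - k))"

text \<open>
  With \<open>N = CARD('n)\<close>, the space \<open>\<real>\<^bsup>N+1\<^esup>\<close> is \<open>real^('n option)\<close>: the index \<open>Some i\<close> stands for
  \<open>i \<le> N\<close>, and \<open>None\<close> for \<open>N + 1\<close>.
\<close>

definition metric_of :: "real^'n \<Rightarrow> ('n::finite option) metric" where
  "metric_of a x =
     (\<chi> j k. if j = k then (case j of Some i \<Rightarrow> exp (- 2 * a $ i * x $ None) | None \<Rightarrow> 1) else 0)"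

lemma metric_inner_metric_of:
  "metric_inner (metric_of a) x u v =
     (\<Sum>i\<in>UNIV. exp (- 2 * a $ i * x $ None) * u $ Some i * v $ Some i) + u $ None * v $ None"
  by (simp add: metric_inner_def metric_of_def inner_vec_def matrix_vector_mult_def UNIV_option_conv
      sum.reindex if_distrib[where f = "\<lambda>c. _ * c"] sum.delta' mult_ac cong: if_cong)

end

theory Submission imports Defs begin

text \<open>
  Write \<open>w\<^sub>i = exp (-2 a\<^sub>i x\<^bsub>N+1\<^esub>)\<close>, \<open>u\<^sub>0 = u\<^bsub>N+1\<^esub>\<close> and \<open>v\<^sub>0 = v\<^bsub>N+1\<^esub>\<close>. The Christoffel symbols give
  \<open>\<langle>R(u, v) v, u\<rangle> = - \<Sum>\<^sub>i a\<^sub>i\<^sup>2 w\<^sub>i (u\<^sub>i v\<^sub>0 - u\<^sub>0 v\<^sub>i)\<^sup>2 - (S(u,u) S(v,v) - S(u,v)\<^sup>2)\<close> with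
  \<open>S(u,v) = \<Sum>\<^sub>i a\<^sub>i w\<^sub>i u\<^sub>i v\<^sub>i\<close>; the formula is the case \<open>w = 1\<close>, \<open>v\<^sub>0 = 0\<close>. By Lagrange's identity, this
  numerator and the Gram determinant in the denominator are, up to sign, the same positive
  combination of squared minors of \<open>(u, v)\<close>, except that in the numerator each term carries a factor
  \<open>a\<^sub>i a\<^sub>j\<close>. Hence the curvature lies between \<open>- max a\<^sub>i a\<^sub>j\<close> and \<open>- min a\<^sub>i a\<^sub>j\<close>, at every point.
\<close>

section \<open>The inverse metric\<close>

lemma matrix_inv_unique:
  fixes A :: "'a::semiring_1^'n^'m"
  assumes "A ** B = mat 1" "B ** A = mat 1"
  shows "matrix_inv A = B"
proof -
  have inv: "A ** matrix_inv A = mat 1 \<and> matrix_inv A ** A = mat 1"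
    unfolding matrix_inv_def by (rule someI[of _ B]) (simp add: assms)
  then have "matrix_inv A = matrix_inv A ** (A ** B)"
    by (simp add: assms)
  also have "\<dots> = B"
    using inv by (simp add: matrix_mul_assoc)
  finally show ?thesis .
qed

lemma if_zero_mult:
  "(if P then c else 0) * d = (if P then c * d else 0)"
  "d * (if P then c else 0) = (if P then d * c else 0)" for c d :: "'a::mult_zero"
  by simp_all

text \<open>The metric is diagonal and its exponents are linear in \<open>x\<close>, so negating
  \<open>x\<close> inverts every entry.\<close>

lemma matrix_inv_metric_of:
  "matrix_inv (metric_of a x) = metric_of a (- x)"
proof (rule matrix_inv_unique)
  have "metric_of a y ** metric_of a (- y) = mat 1" for y
  proof -
    have "(metric_of a y ** metric_of a (- y)) $ j $ k = mat 1 $ j $ k" for j k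
      by (cases j; cases k) (simp_all add: metric_of_def matrix_matrix_mult_def mat_def if_zero_mult
          flip: exp_add)
    then show ?thesis by (simp add: vec_eq_iff)
  qed
  from this[of x] this[of "- x"] show "metric_of a x ** metric_of a (- x) = mat 1"
    "metric_of a (- x) ** metric_of a x = mat 1" by simp_all
qed

section \<open>Coordinate derivatives, Christoffel symbols and curvature coefficients\<close>

lemma sum_UNIV_option:
  "(\<Sum>i\<in>UNIV. f i) = f None + (\<Sum>i\<in>UNIV. f (Some i))" for f :: "'n::finite option \<Rightarrow> 'b::comm_monoid_add"
  by (simp add: UNIV_option_conv sum.reindex)

lemma partial_deriv_const [simp]: "partial_deriv i (\<lambda>x. c) x = 0"
  by (simp add: partial_deriv_def)

text \<open>Along direction \<open>i\<close>, coordinate \<open>j\<close> is either shifted by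
  \<open>t\<close> or constant. This reduces everything to one-variable calculus, since the metric
  depends on the coordinate \<open>None\<close> alone.\<close>

lemma partial_deriv_of_coordinate:
  assumes "(f has_real_derivative D) (at (x $ j))"
  shows "partial_deriv i (\<lambda>y. f (y $ j)) x = (if i = j then D else 0)"
proof (cases "i = j")
  case True
  have "((\<lambda>t. f (x $ j + t)) has_real_derivative D) (at 0)"
    using assms DERIV_shift[of f D 0 "x $ j"] by (simp add: add.commute)
  with True show ?thesis
    by (simp add: partial_deriv_def DERIV_imp_deriv)
qed (simp add: partial_deriv_def axis_def)

lemma partial_deriv_metric_of:
  "partial_deriv i (\<lambda>y. metric_of a y $ j $ k) x =
     (if i = None \<and> j = k
      then (case j of Some m \<Rightarrow> - 2 * a $ m * exp (- 2 * a $ m * x $ None) | None \<Rightarrow> 0) else 0)"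
proof (cases "j = k")
  case True
  show ?thesis
  proof (cases k)
    case (Some m)
    have "((\<lambda>t. exp (- 2 * a $ m * t)) has_real_derivative
        - 2 * a $ m * exp (- 2 * a $ m * x $ None)) (at (x $ None))"
      by (auto intro!: derivative_eq_intros)
    from partial_deriv_of_coordinate[OF this, of i] True Some show ?thesis
      by (simp add: metric_of_def)
  qed (use True in \<open>simp add: metric_of_def\<close>)
qed (simp add: metric_of_def)

text \<open>Only \<open>None\<close>-derivatives of diagonal entries survive. For upper index
  \<open>Some l\<close> the inverse weight cancels the exponential and leaves a constant; for upper
  index \<open>None\<close> the weight remains. Equalities of functions are needed because the
  curvature differentiates the symbols.\<close>

lemma christoffel_metric_of:
  "christoffel (metric_of a) None None j = (\<lambda>x. 0)"
  "christoffel (metric_of a) None i None = (\<lambda>x. 0)"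
  "christoffel (metric_of a) None (Some m) (Some n) =
     (\<lambda>x. if m = n then a $ m * exp (- 2 * a $ m * x $ None) else 0)"
  "christoffel (metric_of a) (Some l) None None = (\<lambda>x. 0)"
  "christoffel (metric_of a) (Some l) (Some m) (Some n) = (\<lambda>x. 0)"
  "christoffel (metric_of a) (Some l) None (Some m) = (\<lambda>x. if l = m then - a $ m else 0)"
  "christoffel (metric_of a) (Some l) (Some m) None = (\<lambda>x. if l = m then - a $ m else 0)"
  unfolding christoffel_def matrix_inv_metric_of partial_deriv_metric_of fun_eq_iff
  by (auto simp: sum_UNIV_option metric_of_def if_zero_mult exp_minus
      cong: if_cong split: option.split)

lemma partial_deriv_if_exp:
  "partial_deriv i (\<lambda>x. if b then c * exp (d * x $ None) else 0) x =
     (if i = None \<and> b then c * d * exp (d * x $ None) else 0)"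
proof (cases b)
  case True
  have "((\<lambda>t. c * exp (d * t)) has_real_derivative c * d * exp (d * x $ None)) (at (x $ None))"
    by (auto intro!: derivative_eq_intros)
  from partial_deriv_of_coordinate[OF this, of i] True show ?thesis by simp
qed simp

text \<open>With upper index \<open>None\<close>, the derivative term \<open>2 a^2 w\<close> is half
  cancelled by the product term. The all-\<open>Some\<close> coefficient comes only from products
  through the intermediate index \<open>None\<close>. Nested conditionals let later sums collapse
  one index at a time.\<close>

lemma riemann_coeff_metric_of:
  fixes a :: "real^'n"
  defines "w \<equiv> \<lambda>x m. exp (- 2 * a $ m * x $ None)"
  shows
  "riemann_coeff (metric_of a) None None None k x = 0"
  "riemann_coeff (metric_of a) None None (Some n) None x = 0"
  "riemann_coeff (metric_of a) None (Some m) None None x = 0"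
  "riemann_coeff (metric_of a) None (Some m) (Some n) None x = 0"
  "riemann_coeff (metric_of a) None None (Some n) (Some p) x =
     (if n = p then - (a $ n)\<^sup>2 * w x n else 0)"
  "riemann_coeff (metric_of a) None (Some m) None (Some p) x =
     (if m = p then (a $ m)\<^sup>2 * w x m else 0)"
  "riemann_coeff (metric_of a) None (Some m) (Some n) (Some p) x = 0"
  "riemann_coeff (metric_of a) (Some l) None None k x = 0"
  "riemann_coeff (metric_of a) (Some l) None (Some n) None x = (if l = n then (a $ l)\<^sup>2 else 0)"
  "riemann_coeff (metric_of a) (Some l) (Some m) None None x = (if l = m then - (a $ l)\<^sup>2 else 0)"
  "riemann_coeff (metric_of a) (Some l) None (Some n) (Some p) x = 0"
  "riemann_coeff (metric_of a) (Some l) (Some m) None (Some p) x = 0"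
  "riemann_coeff (metric_of a) (Some l) (Some m) (Some n) None x = 0"
  "riemann_coeff (metric_of a) (Some l) (Some m) (Some n) (Some p) x =
     (if l = n then if m = p then a $ l * a $ m * w x m else 0 else 0)
     - (if l = m then if n = p then a $ l * a $ n * w x n else 0 else 0)"
  unfolding riemann_coeff_def w_def sum_UNIV_option
  by (simp_all only: christoffel_metric_of partial_deriv_const partial_deriv_if_exp)
    (simp_all add: if_zero_mult sum_subtractf sum_negf power2_eq_square)

section \<open>The curvature tensor and its quadratic form\<close>

lemma sum_if_const: "(\<Sum>i\<in>I. if P then f i else 0) = (if P then \<Sum>i\<in>I. f i else 0)"
  by simp

lemma riemann_metric_of_None:
  "riemann (metric_of a) x u v w $ None =
     (\<Sum>i\<in>UNIV. (a $ i)\<^sup>2 * exp (- 2 * a $ i * x $ None) *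
        (u $ Some i * v $ None - u $ None * v $ Some i) * w $ Some i)"
  by (simp add: riemann_def sum_UNIV_option riemann_coeff_metric_of if_zero_mult
      sum.distrib[symmetric] right_diff_distrib left_diff_distrib sum_subtractf sum_negf mult_ac)

lemma riemann_metric_of_Some:
  "riemann (metric_of a) x u v w $ Some l =
     (a $ l)\<^sup>2 * (u $ None * v $ Some l - u $ Some l * v $ None) * w $ None
     + a $ l * v $ Some l *
         (\<Sum>i\<in>UNIV. a $ i * exp (- 2 * a $ i * x $ None) * u $ Some i * w $ Some i)
     - a $ l * u $ Some l *
         (\<Sum>i\<in>UNIV. a $ i * exp (- 2 * a $ i * x $ None) * v $ Some i * w $ Some i)"
  by (simp add: riemann_def sum_UNIV_option riemann_coeff_metric_of if_zero_mult sum_if_const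
      sum.distrib right_diff_distrib left_diff_distrib sum_subtractf sum_negf sum_distrib_left mult_ac
      cong: if_cong)

lemma riemann_metric_of_inner:
  fixes a :: "real^'n" and x u v :: "real^'n option"
  defines "w \<equiv> \<lambda>i. exp (- 2 * a $ i * x $ None)"
  shows "metric_inner (metric_of a) x (riemann (metric_of a) x u v v) u =
     - (\<Sum>i\<in>UNIV. (a $ i)\<^sup>2 * w i * (u $ Some i * v $ None - u $ None * v $ Some i)\<^sup>2)
     - ((\<Sum>i\<in>UNIV. a $ i * w i * (u $ Some i)\<^sup>2) * (\<Sum>i\<in>UNIV. a $ i * w i * (v $ Some i)\<^sup>2)
        - (\<Sum>i\<in>UNIV. a $ i * w i * u $ Some i * v $ Some i)\<^sup>2)"
proof -
  define S where "S p q = (\<Sum>i\<in>UNIV. a $ i * w i * p $ Some i * q $ Some i)" for p q :: "real^'n option"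
  have "metric_inner (metric_of a) x (riemann (metric_of a) x u v v) u =
    (\<Sum>i\<in>UNIV. w i * ((a $ i)\<^sup>2 * (u $ None * v $ Some i - u $ Some i * v $ None) * v $ None
       + a $ i * v $ Some i * S u v - a $ i * u $ Some i * S v v) * u $ Some i) +
    (\<Sum>i\<in>UNIV. (a $ i)\<^sup>2 * w i * (u $ Some i * v $ None - u $ None * v $ Some i) * v $ Some i) * u $ None"
    by (simp add: metric_inner_metric_of riemann_metric_of_None riemann_metric_of_Some w_def S_def)
  \<comment> \<open>The terms carrying \<open>v $ None\<close> and \<open>u $ None\<close> share the
    factor \<open>u $ Some i * v $ None - u $ None * v $ Some i\<close> and combine to minus its
    square.\<close>
  also have "\<dots> = (\<Sum>i\<in>UNIV. - ((a $ i)\<^sup>2 * w i * (u $ Some i * v $ None - u $ None * v $ Some i)\<^sup>2)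
       + (a $ i * w i * u $ Some i * v $ Some i) * S u v - (a $ i * w i * u $ Some i * u $ Some i) * S v v)"
    unfolding sum_distrib_right sum.distrib[symmetric]
    by (intro sum.cong refl) (simp add: algebra_simps power2_eq_square)
  also have "\<dots> = - (\<Sum>i\<in>UNIV. (a $ i)\<^sup>2 * w i * (u $ Some i * v $ None - u $ None * v $ Some i)\<^sup>2)
       + S u v * S u v - S u u * S v v"
    by (simp add: sum.distrib sum_subtractf sum_negf sum_distrib_right S_def)
  finally show ?thesis
    by (simp add: S_def power2_eq_square mult.assoc)
qed

section \<open>Squared minors and curvature bounds\<close>

text \<open>Expanding the square factors the double sum; ordered pairs count each minor twice, hence
  the half. The weights may have any sign, so the identity serves both \<open>w\<close> (Gram
  determinant) and \<open>a $ i * w i\<close> (numerator).\<close>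

lemma weighted_lagrange_identity:
  fixes c p q :: "'i \<Rightarrow> real"
  shows "(\<Sum>i\<in>I. c i * (p i)\<^sup>2) * (\<Sum>i\<in>I. c i * (q i)\<^sup>2) - (\<Sum>i\<in>I. c i * p i * q i)\<^sup>2 =
    (\<Sum>i\<in>I. \<Sum>j\<in>I. c i * c j * (p i * q j - p j * q i)\<^sup>2) / 2"
proof -
  have "(\<Sum>i\<in>I. \<Sum>j\<in>I. c i * c j * (p i * q j - p j * q i)\<^sup>2) =
    (\<Sum>i\<in>I. \<Sum>j\<in>I. (c i * (p i)\<^sup>2) * (c j * (q j)\<^sup>2) + (c i * (q i)\<^sup>2) * (c j * (p j)\<^sup>2)
       - 2 * ((c i * p i * q i) * (c j * p j * q j)))"
    by (intro sum.cong refl) (simp add: algebra_simps power2_eq_square)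
  also have "\<dots> = (\<Sum>i\<in>I. c i * (p i)\<^sup>2) * (\<Sum>i\<in>I. c i * (q i)\<^sup>2)
      + (\<Sum>i\<in>I. c i * (q i)\<^sup>2) * (\<Sum>i\<in>I. c i * (p i)\<^sup>2)
      - 2 * ((\<Sum>i\<in>I. c i * p i * q i) * (\<Sum>i\<in>I. c i * p i * q i))"
    unfolding sum_product by (simp only: sum.distrib sum_subtractf sum_distrib_left)
  also have "\<dots> = 2 * ((\<Sum>i\<in>I. c i * (p i)\<^sup>2) * (\<Sum>i\<in>I. c i * (q i)\<^sup>2) - (\<Sum>i\<in>I. c i * p i * q i)\<^sup>2)"
    by (simp add: power2_eq_square[of "sum _ _"])
  finally show ?thesis by simp
qed

text \<open>If all minors vanished, dividing by a nonzero coordinate of \<open>v\<close> would make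
  \<open>u\<close> a multiple of \<open>v\<close>.\<close>

lemma independent_pair_minor_nonzero:
  fixes u v :: "real^'m"
  assumes "u \<noteq> v" "independent {u, v}"
  obtains p q where "u $ p * v $ q \<noteq> u $ q * v $ p"
proof -
  have "\<not> (\<forall>p q. u $ p * v $ q = u $ q * v $ p)"
  proof
    assume eq: "\<forall>p q. u $ p * v $ q = u $ q * v $ p"
    have "v \<noteq> 0"
      using assms dependent_zero by blast
    then obtain q where "v $ q \<noteq> 0"
      by (auto simp: vec_eq_iff)
    with eq have "u = (u $ q / v $ q) *\<^sub>R v"
      by (auto simp: vec_eq_iff field_simps)
    then have "u \<in> span {v}"
      by (metis span_base span_scale singletonI)
    with assms show False
      by (simp add: independent_insert)
  qed
  with that show thesis by blast
qed

lemma sectional_curvature_metric_of_bounds: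
  fixes a :: "real^'n"
  assumes k: "\<And>i j. k \<le> a $ i * a $ j" and K: "\<And>i j. a $ i * a $ j \<le> K"
    and "u \<noteq> v" "independent {u, v}"
  shows "- K \<le> sectional_curvature (metric_of a) x u v \<and>
    sectional_curvature (metric_of a) x u v \<le> - k"
proof -
  define w where "w i = exp (- 2 * a $ i * x $ None)" for i
  define r where "r i = (u $ Some i * v $ None - u $ None * v $ Some i)\<^sup>2" for i
  define s where "s i j = (u $ Some i * v $ Some j - u $ Some j * v $ Some i)\<^sup>2" for i j
  \<comment> \<open>Numerator (up to sign) and denominator are the values of this one functional at
    \<open>c i j = a $ i * a $ j\<close> and at \<open>c i j = 1\<close>. It is linear in
    \<open>c\<close> and, as all its weights are nonnegative, monotone.\<close>
  define F where "F c = (\<Sum>i\<in>UNIV. c i i * (w i * r i))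
      + (\<Sum>i\<in>UNIV. \<Sum>j\<in>UNIV. c i j * (w i * w j * s i j)) / 2"
    for c :: "'n \<Rightarrow> 'n \<Rightarrow> real"
  have w: "w i > 0" for i by (simp add: w_def)
  have rs: "r i \<ge> 0" "s i j \<ge> 0" for i j by (simp_all add: r_def s_def)
  have F_mono: "F c \<le> F d" if "\<And>i j. c i j \<le> d i j" for c d
    unfolding F_def using w rs that
    by (intro add_mono divide_right_mono sum_mono mult_right_mono mult_nonneg_nonneg)
       (auto intro: less_imp_le)
  have F_scale: "F (\<lambda>i j. c) = c * F (\<lambda>i j. 1)" for c
    by (simp add: F_def sum_distrib_left algebra_simps)
  have num: "metric_inner (metric_of a) x (riemann (metric_of a) x u v v) u = - F (\<lambda>i j. a $ i * a $ j)"
    unfolding riemann_metric_of_inner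
    using weighted_lagrange_identity[of "\<lambda>i. a $ i * w i" "\<lambda>i. u $ Some i" UNIV "\<lambda>i. v $ Some i"]
    by (simp add: F_def w_def r_def s_def power2_eq_square mult_ac)
  have "metric_inner (metric_of a) x u u * metric_inner (metric_of a) x v v - (metric_inner (metric_of a) x u v)\<^sup>2
    = (\<Sum>i\<in>UNIV. w i * r i) + ((\<Sum>i\<in>UNIV. w i * (u $ Some i)\<^sup>2) * (\<Sum>i\<in>UNIV. w i * (v $ Some i)\<^sup>2)
        - (\<Sum>i\<in>UNIV. w i * u $ Some i * v $ Some i)\<^sup>2)"
  proof -
    have "(\<Sum>i\<in>UNIV. w i * r i) = (v $ None)\<^sup>2 * (\<Sum>i\<in>UNIV. w i * (u $ Some i)\<^sup>2)
       + (u $ None)\<^sup>2 * (\<Sum>i\<in>UNIV. w i * (v $ Some i)\<^sup>2)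
       - 2 * u $ None * v $ None * (\<Sum>i\<in>UNIV. w i * u $ Some i * v $ Some i)"
      unfolding sum_distrib_left sum.distrib[symmetric] sum_subtractf[symmetric]
      by (intro sum.cong refl) (simp add: r_def algebra_simps power2_eq_square)
    then show ?thesis
      unfolding metric_inner_metric_of w_def[symmetric]
      by (simp add: power2_eq_square algebra_simps)
  qed
  also have "\<dots> = F (\<lambda>i j. 1)"
    using weighted_lagrange_identity[of w "\<lambda>i. u $ Some i" UNIV "\<lambda>i. v $ Some i"]
    by (simp add: F_def s_def)
  finally have curv: "sectional_curvature (metric_of a) x u v = - F (\<lambda>i j. a $ i * a $ j) / F (\<lambda>i j. 1)"
    by (simp add: sectional_curvature_def num)
  \<comment> \<open>Otherwise every squared minor, having a positive weight, would be zero, against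
    independence.\<close>
  have "F (\<lambda>i j. 1) > 0"
  proof (rule ccontr)
    assume neg: "\<not> F (\<lambda>i j. 1) > 0"
    let ?R = "\<Sum>i\<in>UNIV. w i * r i" and ?S = "\<Sum>i\<in>UNIV. \<Sum>j\<in>UNIV. w i * w j * s i j"
    have "?R \<ge> 0" "?S \<ge> 0"
      using w rs by (auto intro!: sum_nonneg mult_nonneg_nonneg intro: less_imp_le)
    with neg have "?R = 0" "?S = 0"
      by (simp_all add: F_def)
    then have "r i = 0" "s i j = 0" for i j
      using w rs by (simp_all add: sum_nonneg_eq_0_iff sum_nonneg less_imp_le less_imp_neq[symmetric])
    then have "u $ p * v $ q = u $ q * v $ p" for p q
      by (cases p; cases q) (simp_all add: r_def s_def)
    with independent_pair_minor_nonzero[OF assms(3,4)] show False by blast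
  qed
  moreover have "k * F (\<lambda>i j. 1) \<le> F (\<lambda>i j. a $ i * a $ j)" "F (\<lambda>i j. a $ i * a $ j) \<le> K * F (\<lambda>i j. 1)"
    using F_mono[of "\<lambda>i j. k" "\<lambda>i j. a $ i * a $ j"] F_mono[of "\<lambda>i j. a $ i * a $ j" "\<lambda>i j. K"] k K
    by (simp_all add: F_scale[of k] F_scale[of K])
  ultimately show ?thesis
    by (simp add: curv field_simps)
qed

lemma negative_pinched_metric_of:
  fixes a :: "real^'n"
  assumes "(\<forall>i. a $ i > 0) \<or> (\<forall>i. a $ i < 0)"
  shows "negative_pinched_curvature (metric_of a)"
proof -
  \<comment> \<open>Finitely many products, all positive by the sign hypothesis: their minimum and
    maximum are pinching constants independent of the point and the plane.\<close>
  define A where "A = range (\<lambda>(i, j). a $ i * a $ j)"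
  have "finite A" "A \<noteq> {}" by (auto simp: A_def)
  have A: "a $ i * a $ j \<in> A" for i j by (auto simp: A_def)
  have "\<forall>c\<in>A. c > 0"
    using assms by (auto simp: A_def mult_pos_pos mult_neg_neg)
  then have "Min A > 0" "Min A \<le> Max A"
    using \<open>finite A\<close> \<open>A \<noteq> {}\<close> by auto
  moreover have "Min A \<le> a $ i * a $ j" "a $ i * a $ j \<le> Max A" for i j
    using A \<open>finite A\<close> by auto
  ultimately show ?thesis
    unfolding negative_pinched_curvature_def
    using sectional_curvature_metric_of_bounds by blast
qed

theorem proposition5:
  fixes a :: "real^'n"
  shows "(\<forall>(lam::real) (mu::real) (Xc::real^'n) (Yc::real^'n) X Y P Q.
            X = (\<Sum>i\<in>UNIV. Xc $ i *\<^sub>R axis (Some i) 1) \<and>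
            Y = (\<Sum>i\<in>UNIV. Yc $ i *\<^sub>R axis (Some i) 1) \<and>
            P = lam *\<^sub>R axis None 1 + mu *\<^sub>R X \<and> Q = Y \<and>
            lam\<^sup>2 + mu\<^sup>2 = 1 \<and>
            metric_inner (metric_of a) 0 P P = 1 \<and>
            metric_inner (metric_of a) 0 Q Q = 1 \<and>
            metric_inner (metric_of a) 0 P Q = 0 \<longrightarrow>
            sectional_curvature (metric_of a) 0 P Q =
              - lam\<^sup>2 * (\<Sum>i\<in>UNIV. (a $ i)\<^sup>2 * (Yc $ i)\<^sup>2)
              - mu\<^sup>2 * ((\<Sum>i\<in>UNIV. a $ i * (Xc $ i)\<^sup>2) * (\<Sum>i\<in>UNIV. a $ i * (Yc $ i)\<^sup>2)
                        - (\<Sum>i\<in>UNIV. a $ i * Xc $ i * Yc $ i)\<^sup>2)) \<and>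
         ((\<forall>i. a $ i > 0) \<or> (\<forall>i. a $ i < 0) \<longrightarrow>
            negative_pinched_curvature (metric_of a))"
proof (intro conjI allI impI, elim conjE)
  fix lam mu :: real and Xc Yc :: "real^'n" and X Y P Q :: "real^'n option"
  assume X: "X = (\<Sum>i\<in>UNIV. Xc $ i *\<^sub>R axis (Some i) 1)" and Y: "Y = (\<Sum>i\<in>UNIV. Yc $ i *\<^sub>R axis (Some i) 1)"
    and PQ: "P = lam *\<^sub>R axis None 1 + mu *\<^sub>R X" "Q = Y"
    and orth: "metric_inner (metric_of a) 0 P P = 1" "metric_inner (metric_of a) 0 Q Q = 1"
      "metric_inner (metric_of a) 0 P Q = 0"
  have "P $ None = lam" "P $ Some i = mu * Xc $ i" "Q $ None = 0" "Q $ Some i = Yc $ i" for i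
    by (simp_all add: PQ X Y axis_def if_distrib cong: if_cong)
  moreover have "(\<Sum>i\<in>UNIV. a $ i * (mu * Xc $ i)\<^sup>2) = mu\<^sup>2 * (\<Sum>i\<in>UNIV. a $ i * (Xc $ i)\<^sup>2)"
    "(\<Sum>i\<in>UNIV. a $ i * (mu * Xc $ i) * Yc $ i) = mu * (\<Sum>i\<in>UNIV. a $ i * Xc $ i * Yc $ i)"
    "(\<Sum>i\<in>UNIV. (a $ i)\<^sup>2 * (lam * Yc $ i)\<^sup>2) = lam\<^sup>2 * (\<Sum>i\<in>UNIV. (a $ i)\<^sup>2 * (Yc $ i)\<^sup>2)"
    by (simp_all add: sum_distrib_left power_mult_distrib mult_ac)
  ultimately show "sectional_curvature (metric_of a) 0 P Q =
      - lam\<^sup>2 * (\<Sum>i\<in>UNIV. (a $ i)\<^sup>2 * (Yc $ i)\<^sup>2)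
      - mu\<^sup>2 * ((\<Sum>i\<in>UNIV. a $ i * (Xc $ i)\<^sup>2) * (\<Sum>i\<in>UNIV. a $ i * (Yc $ i)\<^sup>2)
                - (\<Sum>i\<in>UNIV. a $ i * Xc $ i * Yc $ i)\<^sup>2)"
    \<comment> \<open>Orthonormality makes the denominator 1, and at the origin every weight is
      \<open>exp 0\<close>.\<close>
    by (simp add: sectional_curvature_def orth riemann_metric_of_inner)
       (simp add: power_mult_distrib right_diff_distrib mult_ac)
qed (rule negative_pinched_metric_of)

end
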